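(* Let $(p_n)$ and $(p_n')$ be two sets of orthogonal polynomials with real recurrence coefficients, given by $p_{-1}=p_{-1}'=0$, $p_0=p_0'=1$ and, for $n\ge 0$, $$\alpha_{n+1}p_{n+1}(x)=(x-\beta_n)p_n(x)-\gamma_{n-1}p_{n-1}(x),\qquad \alpha_{n+1}'p_{n+1}'(x)=(x-\beta_n')p_n'(x)-\gamma_{n-1}'p_{n-1}'(x),$$ with the convention $\alpha_0=\alpha_0'=0$. Suppose that $\alpha_i,\alpha_i'>0$ for all $i\ge 1$, that $\gamma_i,\gamma_i'>0$ for all $i\ge 0$, and that for all integers $j\ge i\ge 0$, $$\beta_j\ge\beta_i',\qquad \alpha_j\ge\alpha_i',\qquad \alpha_j+\gamma_j\ge\alpha_i'+\gamma_i',\qquad \gamma_j\ge\alpha_i'.$$ Let $m,k,n$ be non-negative integers with $k\le\max\{m,n\}$, and let $b_{mk}^n$ denote the coefficient of $p_n(x)$ in the expansion of $p_m(x)p_k'(x)$ in the basis $(p_l)_{l\ge 0}$. Then $b_{mk}^n\ge 0$.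
   Context: The coefficients $b_{mk}^n$ are defined by $p_m(x)p_k'(x)=\sum_{n} b_{mk}^n\,p_n(x)$. *)

theory Defs
  imports Complex_Main "HOL-Computational_Algebra.Polynomial"
begin

text \<open>
  By convention \<open>p (-1) = 0\<close>, so the last term vanishes for \<open>n = 0\<close> and no \<open>\<gamma> (-1)\<close> is needed.
  The recurrence does not involve \<open>\<alpha> 0\<close>.
\<close>

definition three_term_recurrence ::
    "(nat \<Rightarrow> real) \<Rightarrow> (nat \<Rightarrow> real) \<Rightarrow> (nat \<Rightarrow> real) \<Rightarrow> (nat \<Rightarrow> real poly) \<Rightarrow> bool" where
  "three_term_recurrence \<alpha> \<beta> \<gamma> p \<longleftrightarrow>
     p 0 = 1 \<and>
     (\<forall>n. smult (\<alpha> (Suc n)) (p (Suc n)) =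
          [:- \<beta> n, 1:] * p n - (if n = 0 then 0 else smult (\<gamma> (n - 1)) (p (n - 1))))"

definition expands_as :: "(nat \<Rightarrow> real poly) \<Rightarrow> real poly \<Rightarrow> (nat \<Rightarrow> real) \<Rightarrow> bool" where
  "expands_as p q c \<longleftrightarrow>
     finite {n. c n \<noteq> 0} \<and> q = (\<Sum>n | c n \<noteq> 0. smult (c n) (p n))"

text \<open>
  Meaningful whenever \<open>p\<close> is a basis; the lemma \<open>expands_as_expansion_coeff\<close> below shows
  that this holds if \<open>p\<close> satisfies a three-term recurrence
  in which no \<open>\<alpha> (Suc n)\<close> vanishes.
\<close>

definition expansion_coeff :: "(nat \<Rightarrow> real poly) \<Rightarrow> real poly \<Rightarrow> nat \<Rightarrow> real" where
  "expansion_coeff p q = (THE c. expands_as p q c)"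

definition linearization_coeff ::
    "(nat \<Rightarrow> real poly) \<Rightarrow> (nat \<Rightarrow> real poly) \<Rightarrow> nat \<Rightarrow> nat \<Rightarrow> nat \<Rightarrow> real" where
  "linearization_coeff p p' m k n = expansion_coeff p (p m * p' k) n"

lemma three_term_recurrence_degree:
  assumes "three_term_recurrence \<alpha> \<beta> \<gamma> p" and "\<And>n. \<alpha> (Suc n) \<noteq> 0"
  shows "p n \<noteq> 0 \<and> degree (p n) = n"
proof (induction n rule: less_induct)
  case (less n)
  show ?case
  proof (cases n)
    case 0
    then show ?thesis using assms(1) by (simp add: three_term_recurrence_def)
  next
    case (Suc k)
    define r where "r = (if k = 0 then 0 else smult (\<gamma> (k - 1)) (p (k - 1)))"
    have eq: "smult (\<alpha> n) (p n) = [:- \<beta> k, 1:] * p k - r"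
      using assms(1) Suc by (simp add: three_term_recurrence_def r_def)
    have pk: "p k \<noteq> 0" "degree (p k) = k" using less Suc by auto
    have d: "degree ([:- \<beta> k, 1:] * p k) = n"
      using pk Suc by (subst degree_mult_eq) auto
    have "degree r \<le> k"
    proof (cases "k = 0")
      case False
      then have "degree (p (k - 1)) = k - 1" using less Suc by auto
      then show ?thesis
        using degree_smult_le[of "\<gamma> (k - 1)" "p (k - 1)"] by (simp add: r_def)
    qed (simp add: r_def)
    then have "degree ([:- \<beta> k, 1:] * p k - r) = n"
      using d Suc by (simp add: degree_add_eq_left[where q = "- r", simplified])
    then have "degree (smult (\<alpha> n) (p n)) = n" by (simp only: eq)
    then have "degree (p n) = n" using assms(2)[of k] Suc by simp
    then show ?thesis using Suc by auto
  qed
qed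

lemma expands_as_exists:
  assumes "\<And>n. p n \<noteq> 0 \<and> degree (p n) = n"
  shows "\<exists>c. expands_as p q c"
proof -
  have "\<exists>c. (\<forall>n\<ge>d. c n = 0) \<and> q = (\<Sum>n<d. smult (c n) (p n))" if "\<forall>i\<ge>d. coeff q i = 0" for d
    using that
  proof (induction d arbitrary: q)
    case 0
    then show ?case by (auto intro!: exI[of _ "\<lambda>_. 0"] poly_eqI)
  next
    case (Suc d)
    have lc: "coeff (p d) d \<noteq> 0" using assms[of d] by (metis leading_coeff_0_iff)
    define a where "a = coeff q d / coeff (p d) d"
    have "\<forall>i\<ge>d. coeff (q - smult a (p d)) i = 0"
    proof (intro allI impI)
      fix i assume "d \<le> i"
      then consider "i = d" | "i \<ge> Suc d" by linarith
      then show "coeff (q - smult a (p d)) i = 0"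
      proof cases
        case 1
        then show ?thesis using lc by (simp add: a_def)
      next
        case 2
        then show ?thesis using Suc.prems assms[of d] by (simp add: coeff_eq_0)
      qed
    qed
    from Suc.IH[OF this] obtain c where
      c: "\<forall>n\<ge>d. c n = 0" "q - smult a (p d) = (\<Sum>n<d. smult (c n) (p n))" by auto
    have "q = (\<Sum>n<d. smult (c n) (p n)) + smult a (p d)" using c(2) by (simp add: diff_eq_eq)
    then show ?case using c(1) by (intro exI[of _ "c(d := a)"]) auto
  qed
  from this[of "Suc (degree q)"] obtain c where
    c: "\<forall>n\<ge>Suc (degree q). c n = 0" "q = (\<Sum>n<Suc (degree q). smult (c n) (p n))"
    by (auto simp: coeff_eq_0)
  have sub: "{n. c n \<noteq> 0} \<subseteq> {..<Suc (degree q)}" using c(1) not_less by blast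
  have "q = (\<Sum>n | c n \<noteq> 0. smult (c n) (p n))"
    by (subst c(2), rule sum.mono_neutral_right) (use sub in auto)
  then show ?thesis using sub finite_subset unfolding expands_as_def by blast
qed

lemma expands_as_unique:
  assumes p: "\<And>n. p n \<noteq> 0 \<and> degree (p n) = n"
    and c: "expands_as p q c" and e: "expands_as p q e"
  shows "c = e"
proof (rule ccontr)
  assume "c \<noteq> e"
  define A where "A = {n. c n \<noteq> 0} \<union> {n. e n \<noteq> 0}"
  define D where "D = {n. c n \<noteq> e n}"
  have fA: "finite A" using c e by (simp add: A_def expands_as_def)
  have "D \<subseteq> A" by (auto simp: A_def D_def)
  then have fD: "finite D" using fA finite_subset by blast
  have D: "D \<noteq> {}" using \<open>c \<noteq> e\<close> by (auto simp: D_def)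
  define M where "M = Max D"
  have M: "M \<in> D" "\<And>n. n \<in> D \<Longrightarrow> n \<le> M" using fD D by (auto simp: M_def)
  have "q = (\<Sum>n\<in>A. smult (c n) (p n))"
    using c fA unfolding expands_as_def A_def
    by (metis (mono_tags, lifting) Diff_iff mem_Collect_eq smult_0_left sum.mono_neutral_left Un_upper1)
  moreover have "q = (\<Sum>n\<in>A. smult (e n) (p n))"
    using e fA unfolding expands_as_def A_def
    by (metis (mono_tags, lifting) Diff_iff mem_Collect_eq smult_0_left sum.mono_neutral_left Un_upper2)
  ultimately have "(\<Sum>n\<in>A. smult (c n - e n) (p n)) = 0"
    by (simp add: smult_diff_left sum_subtractf)
  then have "(\<Sum>n\<in>A. (c n - e n) * coeff (p n) M) = 0"
    by (metis (no_types, lifting) coeff_0 coeff_smult coeff_sum sum.cong)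
  also have "(\<Sum>n\<in>A. (c n - e n) * coeff (p n) M) = (\<Sum>n\<in>{M}. (c n - e n) * coeff (p n) M)"
  proof (rule sum.mono_neutral_right[OF fA])
    show "{M} \<subseteq> A" using M \<open>D \<subseteq> A\<close> by auto
    show "\<forall>i\<in>A - {M}. (c i - e i) * coeff (p i) M = 0"
    proof
      fix i assume i: "i \<in> A - {M}"
      show "(c i - e i) * coeff (p i) M = 0"
      proof (cases "i \<in> D")
        case True
        then have "i < M" using M(2) i by force
        then show ?thesis using p[of i] by (simp add: coeff_eq_0)
      qed (simp add: D_def)
    qed
  qed
  finally have "(c M - e M) * coeff (p M) M = 0" by simp
  moreover have "coeff (p M) M \<noteq> 0" using p[of M] by (metis leading_coeff_0_iff)
  ultimately show False using M(1) by (simp add: D_def)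
qed

lemma expands_as_expansion_coeff:
  assumes "three_term_recurrence \<alpha> \<beta> \<gamma> p" and "\<And>n. \<alpha> (Suc n) \<noteq> 0"
  shows "expands_as p q (expansion_coeff p q)"
proof -
  note deg = three_term_recurrence_degree[OF assms]
  obtain c where c: "expands_as p q c" using expands_as_exists[of p] deg by blast
  show ?thesis unfolding expansion_coeff_def
    using c by (rule theI[where P = "expands_as p q"]) (rule expands_as_unique[of p, OF deg _ c])
qed

end

theory Submission
  imports Defs
begin

text \<open>
  Let \<open>\<phi> q\<close> be the coefficient of \<open>p 0\<close> in \<open>q\<close> (\<open>moment\<close> below). The \<open>p n\<close> are orthogonal for \<open>\<phi>\<close>
  with positive norms \<open>h n = \<phi> (p n * p n)\<close> (\<open>orthogonality\<close>, \<open>norm_pos\<close>; this is the algebraic half of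
  Favard's theorem), so the coefficient of \<open>p n\<close> in \<open>p m * p' k\<close> is \<open>\<phi> (p m * p' k * p n) / h n\<close>.
  Its sign is therefore symmetric in \<open>m\<close> and \<open>n\<close>, and it suffices to treat \<open>k \<le> n\<close>.

  For fixed \<open>m\<close>, put \<open>f i j = \<phi> (p i * p' j * p m)\<close>. Multiplication by \<open>x\<close> can be expanded through \<open>p i\<close> or
  through \<open>p' j\<close>, so \<open>f\<close> solves a discrete hyperbolic equation \<open>L f = L' f\<close>, where the Jacobi operator
  \<open>L\<close> acts on \<open>i\<close> and \<open>L'\<close> acts on \<open>j\<close>; orthogonality gives \<open>f i 0 \<ge> 0\<close>. Pair the equation with the
  indicator function \<open>w\<close> of every other point of the triangle below \<open>(n, k)\<close> whose legs
  have slope 1 and -1, and move both operators onto \<open>w\<close> by Green's formula. The coefficient of \<open>f n k\<close>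
  becomes \<open>- \<alpha>' k\<close>, while every other nonzero coefficient sits at a point with \<open>j \<le> i\<close> and \<open>j < k\<close> and is one of
  \<open>\<beta> i - \<beta>' j\<close> (points of \<open>w\<close>), \<open>\<alpha> i + \<gamma> i - \<alpha>' j - \<gamma>' j\<close> (points between them),
  \<open>\<gamma> i - \<alpha>' j\<close> (left leg) and \<open>\<alpha> i - \<alpha>' j\<close> (right leg). These are the quantities
  assumed to be nonnegative, so induction on \<open>k\<close> gives \<open>f n k \<ge> 0\<close> (\<open>hyperbolic_nonneg\<close>).
\<close>

section \<open>Jacobi operators and Green's formula\<close>

definition jacobi ::
    "(nat \<Rightarrow> real) \<Rightarrow> (nat \<Rightarrow> real) \<Rightarrow> (nat \<Rightarrow> real) \<Rightarrow> (nat \<Rightarrow> real) \<Rightarrow> nat \<Rightarrow> real" where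
  "jacobi \<alpha> \<beta> \<gamma> f i =
     \<alpha> (Suc i) * f (Suc i) + \<beta> i * f i + (if i = 0 then 0 else \<gamma> (i - 1) * f (i - 1))"

text \<open>
  The formula is the transpose of \<open>jacobi\<close> only if \<open>\<alpha> 0 = 0\<close>: at \<open>i = 0\<close> the truncated index
  \<open>i - 1\<close> denotes \<open>0\<close>, and the term has to vanish.
\<close>

definition jacobi_adjoint ::
    "(nat \<Rightarrow> real) \<Rightarrow> (nat \<Rightarrow> real) \<Rightarrow> (nat \<Rightarrow> real) \<Rightarrow> (nat \<Rightarrow> real) \<Rightarrow> nat \<Rightarrow> real" where
  "jacobi_adjoint \<alpha> \<beta> \<gamma> w i = \<alpha> i * w (i - 1) + \<beta> i * w i + \<gamma> i * w (Suc i)"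

lemma green_formula:
  assumes "\<alpha> 0 = 0"
  shows "(\<Sum>i<Suc N. w i * jacobi \<alpha> \<beta> \<gamma> f i) =
         (\<Sum>i<Suc N. jacobi_adjoint \<alpha> \<beta> \<gamma> w i * f i)
           + \<alpha> (Suc N) * w N * f (Suc N) - \<gamma> N * w (Suc N) * f N"
  by (induction N) (use assms in \<open>simp_all add: jacobi_def jacobi_adjoint_def algebra_simps\<close>)

corollary green_formula_finite_support:
  assumes "\<alpha> 0 = 0" and "\<And>i. N \<le> i \<Longrightarrow> w i = 0"
  shows "(\<Sum>i<Suc N. w i * jacobi \<alpha> \<beta> \<gamma> f i) = (\<Sum>i<Suc N. jacobi_adjoint \<alpha> \<beta> \<gamma> w i * f i)"
  using green_formula[of \<alpha> w \<beta> \<gamma> f N] assms by simp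

section \<open>The discrete hyperbolic boundary value problem\<close>

definition checkerboard_triangle :: "nat \<Rightarrow> nat \<Rightarrow> nat \<Rightarrow> nat \<Rightarrow> real" where
  "checkerboard_triangle n k i j =
     (if n + j < i + k \<and> i + j < n + k \<and> odd (n + k + i + j) then 1 else 0)"

locale hyperbolic_coefficients =
  fixes \<alpha> \<beta> \<gamma> \<alpha>' \<beta>' \<gamma>' :: "nat \<Rightarrow> real"
  assumes alpha_0: "\<alpha> 0 = 0" "\<alpha>' 0 = 0"
    and alpha'_pos: "\<And>i. i \<ge> 1 \<Longrightarrow> \<alpha>' i > 0"
    and beta_le: "\<And>i j. j \<le> i \<Longrightarrow> \<beta>' j \<le> \<beta> i"
    and alpha_le: "\<And>i j. j \<le> i \<Longrightarrow> \<alpha>' j \<le> \<alpha> i"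
    and alpha_gamma_le: "\<And>i j. j \<le> i \<Longrightarrow> \<alpha>' j + \<gamma>' j \<le> \<alpha> i + \<gamma> i"
    and alpha_le_gamma: "\<And>i j. j \<le> i \<Longrightarrow> \<alpha>' j \<le> \<gamma> i"
begin

text \<open>
  The coefficient of \<open>f i j\<close> after the difference of the two operators has been moved from \<open>f\<close>
  onto the weight.
\<close>

definition weight_defect :: "nat \<Rightarrow> nat \<Rightarrow> nat \<Rightarrow> nat \<Rightarrow> real" where
  "weight_defect n k i j =
     jacobi_adjoint \<alpha> \<beta> \<gamma> (\<lambda>i. checkerboard_triangle n k i j) i
     - jacobi_adjoint \<alpha>' \<beta>' \<gamma>' (\<lambda>j. checkerboard_triangle n k i j) j"

lemma weight_defect_apex:
  assumes "1 \<le> k"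
  shows "weight_defect n k n k = - \<alpha>' k"
  using assms
  by (auto simp: weight_defect_def jacobi_adjoint_def checkerboard_triangle_def)

text \<open>
  The weight differs from zero only at points of odd parity relative to \<open>(n, k)\<close>, and the operators
  couple such a point to points of even parity. Hence either only the diagonal
  coefficients or only the neighbour coefficients contribute, and which neighbours lie in the support
  depends on the position relative to the legs. Neighbours missing at \<open>i = 0\<close> and \<open>j = 0\<close> do no harm
  because \<open>\<alpha> 0 = \<alpha>' 0 = 0\<close>, and \<open>k \<le> n\<close> keeps the triangle in the region \<open>j \<le> i\<close>, where
  the coefficients can be compared.
\<close>

lemma weight_defect_nonneg:
  assumes "k \<le> n" and "(i, j) \<noteq> (n, k)"
  shows "weight_defect n k i j = 0 \<or> (j < k \<and> j \<le> i \<and> weight_defect n k i j \<ge> 0)"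
proof -
  let ?w = "checkerboard_triangle n k"
  have defect: "weight_defect n k i j =
      (\<beta> i - \<beta>' j) * ?w i j + \<alpha> i * ?w (i - 1) j + \<gamma> i * ?w (Suc i) j
      - \<alpha>' j * ?w i (j - 1) - \<gamma>' j * ?w i (Suc j)"
    by (simp add: weight_defect_def jacobi_adjoint_def algebra_simps)
  consider
      (on_weight) "odd (n + k + i + j)"
    | (outside) "even (n + k + i + j)" "n + j > i + k \<or> i + j > n + k"
    | (left_leg) "even (n + k + i + j)" "n + j = i + k" "i + j < n + k"
    | (right_leg) "even (n + k + i + j)" "n + j < i + k" "i + j = n + k"
    | (interior) "even (n + k + i + j)" "n + j < i + k" "i + j < n + k"
    using assms(2) by fastforce
  then show ?thesis
  proof cases
    case on_weight
    have "weight_defect n k i j = (\<beta> i - \<beta>' j) * ?w i j"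
      unfolding defect using on_weight alpha_0
      by (cases i; cases j) (simp_all add: checkerboard_triangle_def del: even_add)
    then show ?thesis
      using beta_le[of j i] assms(1) by (auto simp: checkerboard_triangle_def)
  next
    case outside
    (* By parity, strict inequalities between the coordinates here leave a gap of at least 2;
       the same holds in the remaining cases, where it puts the neighbours inside the support. *)
    have "n + j > Suc (i + k) \<or> i + j > Suc (n + k)"
      using outside by presburger
    then have "weight_defect n k i j = 0"
      unfolding defect using alpha_0 assms(1)
      by (elim disjE; cases i; cases j) (simp_all add: checkerboard_triangle_def del: even_add)
    then show ?thesis by simp
  next
    case left_leg
    have sharp: "Suc (i + j) < n + k"
      using left_leg by presburger
    have "weight_defect n k i j = \<gamma> i - \<alpha>' j"
      unfolding defect using left_leg sharp alpha_0
      by (cases i; cases j) (simp_all add: checkerboard_triangle_def del: even_add)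
    then show ?thesis
      using alpha_le_gamma[of j i] assms(1) left_leg by auto
  next
    case right_leg
    have sharp: "Suc (n + j) < i + k"
      using right_leg by presburger
    have "weight_defect n k i j = \<alpha> i - \<alpha>' j"
      unfolding defect using right_leg sharp alpha_0
      by (cases i; cases j) (simp_all add: checkerboard_triangle_def del: even_add)
    then show ?thesis
      using alpha_le[of j i] assms(1) right_leg by auto
  next
    case interior
    have sharp: "Suc (n + j) < i + k" "Suc (i + j) < n + k"
      using interior by presburger+
    have "weight_defect n k i j = \<alpha> i + \<gamma> i - (\<alpha>' j + \<gamma>' j)"
      unfolding defect using interior sharp alpha_0
      by (cases i; cases j) (simp_all add: checkerboard_triangle_def del: even_add)
    then show ?thesis
      using alpha_gamma_le[of j i] assms(1) interior by auto
  qed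
qed

text \<open>
  A minimum principle: since the defect is negative at the apex alone, the paired equation expresses
  \<open>\<alpha>' k * f n k\<close> as a combination, with nonnegative coefficients, 
  of values \<open>f i j\<close> with \<open>j < k\<close> and \<open>j \<le> i\<close>.
\<close>

theorem hyperbolic_nonneg:
  assumes eq: "\<And>i j. jacobi \<alpha> \<beta> \<gamma> (\<lambda>i. f i j) i = jacobi \<alpha>' \<beta>' \<gamma>' (\<lambda>j. f i j) j"
    and boundary: "\<And>i. f i 0 \<ge> 0"
    and "k \<le> n"
  shows "f n k \<ge> 0"
  using \<open>k \<le> n\<close>
proof (induction k arbitrary: n rule: less_induct)
  case (less k)
  show ?case
  proof (cases "k = 0")
    case True
    then show ?thesis using boundary by simp
  next
    case False
    let ?w = "checkerboard_triangle n k"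
    let ?I = "{..<Suc (n + k)}" and ?J = "{..<Suc k}"
    (* The rectangle contains the support of the weight and all neighbours of the support. *)
    have left: "(\<Sum>j\<in>?J. \<Sum>i\<in>?I. ?w i j * jacobi \<alpha> \<beta> \<gamma> (\<lambda>i. f i j) i) =
        (\<Sum>j\<in>?J. \<Sum>i\<in>?I. jacobi_adjoint \<alpha> \<beta> \<gamma> (\<lambda>i. ?w i j) i * f i j)"
      by (intro sum.cong refl green_formula_finite_support)
         (auto simp: alpha_0 checkerboard_triangle_def)
    have right: "(\<Sum>i\<in>?I. \<Sum>j\<in>?J. ?w i j * jacobi \<alpha>' \<beta>' \<gamma>' (\<lambda>j. f i j) j) =
        (\<Sum>i\<in>?I. \<Sum>j\<in>?J. jacobi_adjoint \<alpha>' \<beta>' \<gamma>' (\<lambda>j. ?w i j) j * f i j)"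
      by (intro sum.cong refl green_formula_finite_support)
         (auto simp: alpha_0 checkerboard_triangle_def)
    have "(\<Sum>j\<in>?J. \<Sum>i\<in>?I. jacobi_adjoint \<alpha> \<beta> \<gamma> (\<lambda>i. ?w i j) i * f i j) =
        (\<Sum>j\<in>?J. \<Sum>i\<in>?I. jacobi_adjoint \<alpha>' \<beta>' \<gamma>' (\<lambda>j. ?w i j) j * f i j)"
      using left right by (simp only: eq sum.swap[where A = ?I and B = ?J])
    then have "0 = (\<Sum>j\<in>?J. \<Sum>i\<in>?I. weight_defect n k i j * f i j)"
      by (simp only: weight_defect_def left_diff_distrib sum_subtractf)
    also have "\<dots> = (\<Sum>z\<in>?J \<times> ?I. weight_defect n k (snd z) (fst z) * f (snd z) (fst z))"
      unfolding sum.cartesian_product by (intro sum.cong) auto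
    also have "\<dots> = - \<alpha>' k * f n k +
        (\<Sum>z\<in>?J \<times> ?I - {(k, n)}. weight_defect n k (snd z) (fst z) * f (snd z) (fst z))"
      using False by (subst sum.remove[of _ "(k, n)"]) (auto simp: weight_defect_apex)
    finally have "\<alpha>' k * f n k =
        (\<Sum>z\<in>?J \<times> ?I - {(k, n)}. weight_defect n k (snd z) (fst z) * f (snd z) (fst z))"
      by simp
    also have "\<dots> \<ge> 0"
    proof (rule sum_nonneg)
      fix z assume "z \<in> ?J \<times> ?I - {(k, n)}"
      then have "(snd z, fst z) \<noteq> (n, k)" by auto
      from weight_defect_nonneg[OF less.prems this]
      show "0 \<le> weight_defect n k (snd z) (fst z) * f (snd z) (fst z)"
        using less.IH by auto
    qed
    finally show ?thesis
      using alpha'_pos[of k] False by (simp add: zero_le_mult_iff)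
  qed
qed

end

section \<open>Orthogonality with respect to the coefficient of \<open>p 0\<close>\<close>

lemma expands_asI:
  assumes "finite A" and "\<And>n. n \<notin> A \<Longrightarrow> c n = 0" and "q = (\<Sum>n\<in>A. smult (c n) (p n))"
  shows "expands_as p q c"
proof -
  have "{n. c n \<noteq> 0} \<subseteq> A" using assms(2) by blast
  then show ?thesis
    using assms unfolding expands_as_def
    by (auto intro: finite_subset intro!: sum.mono_neutral_right)
qed

lemma expands_as_sum:
  assumes "expands_as p q c" and "finite A" and "{n. c n \<noteq> 0} \<subseteq> A"
  shows "q = (\<Sum>n\<in>A. smult (c n) (p n))"
  using assms unfolding expands_as_def by (auto intro!: sum.mono_neutral_left)

locale orthogonal_polynomials =
  fixes \<alpha> \<beta> \<gamma> :: "nat \<Rightarrow> real" and p :: "nat \<Rightarrow> real poly"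
  assumes recurrence: "three_term_recurrence \<alpha> \<beta> \<gamma> p"
    and alpha_pos: "\<And>i. i \<ge> 1 \<Longrightarrow> \<alpha> i > 0"
    and gamma_pos: "\<And>i. \<gamma> i > 0"
begin

lemma alpha_Suc_neq_0: "\<alpha> (Suc i) \<noteq> 0"
  using alpha_pos[of "Suc i"] by simp

lemma expands_as_coeff: "expands_as p q (expansion_coeff p q)"
  by (rule expands_as_expansion_coeff[OF recurrence alpha_Suc_neq_0])

lemma expansion_coeff_eqI:
  assumes "expands_as p q c"
  shows "expansion_coeff p q = c"
proof (rule expands_as_unique[OF _ expands_as_coeff assms])
  show "p n \<noteq> 0 \<and> degree (p n) = n" for n
    by (rule three_term_recurrence_degree[OF recurrence alpha_Suc_neq_0])
qed

lemma expansion_coeff_add: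
  "expansion_coeff p (q + r) l = expansion_coeff p q l + expansion_coeff p r l"
proof -
  let ?c = "expansion_coeff p q" and ?d = "expansion_coeff p r"
  let ?A = "{n. ?c n \<noteq> 0} \<union> {n. ?d n \<noteq> 0}"
  have fin: "finite ?A" using expands_as_coeff by (simp add: expands_as_def)
  have "q + r = (\<Sum>n\<in>?A. smult (?c n) (p n)) + (\<Sum>n\<in>?A. smult (?d n) (p n))"
    using expands_as_sum[OF expands_as_coeff[of q] fin] expands_as_sum[OF expands_as_coeff[of r] fin]
    by auto
  then have "expands_as p (q + r) (\<lambda>n. ?c n + ?d n)"
    by (intro expands_asI[OF fin]) (auto simp: smult_add_left sum.distrib)
  then show ?thesis by (simp add: expansion_coeff_eqI)
qed

lemma expansion_coeff_smult: "expansion_coeff p (smult a q) l = a * expansion_coeff p q l"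
proof -
  let ?c = "expansion_coeff p q"
  have fin: "finite {n. ?c n \<noteq> 0}" using expands_as_coeff by (simp add: expands_as_def)
  have "smult a q = (\<Sum>n | ?c n \<noteq> 0. smult (a * ?c n) (p n))"
    using arg_cong[OF expands_as_sum[OF expands_as_coeff[of q] fin order.refl], of "smult a"]
    using sum_comp_morphism[of "smult a" "\<lambda>n. smult (?c n) (p n)" "{n. ?c n \<noteq> 0}"]
    by (simp add: smult_add_right comp_def)
  then have "expands_as p (smult a q) (\<lambda>n. a * ?c n)"
    by (intro expands_asI[OF fin]) auto
  then show ?thesis by (simp add: expansion_coeff_eqI)
qed

lemma expansion_coeff_basis: "expansion_coeff p (p i) l = (if l = i then 1 else 0)"
proof -
  have "expands_as p (p i) (\<lambda>l. if l = i then 1 else 0)"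
    by (rule expands_asI[of "{i}"]) auto
  then show ?thesis by (simp add: expansion_coeff_eqI)
qed

definition moment :: "real poly \<Rightarrow> real" where
  "moment q = expansion_coeff p q 0"

lemma moment_add: "moment (q + r) = moment q + moment r"
  and moment_smult: "moment (smult a q) = a * moment q"
  by (simp_all add: moment_def expansion_coeff_add expansion_coeff_smult)

lemma moment_0: "moment 0 = 0"
  using moment_smult[of 0 0] by simp

lemma moment_sum: "moment (sum g A) = (\<Sum>x\<in>A. moment (g x))"
  using sum_comp_morphism[of moment g A] by (simp add: moment_0 moment_add comp_def)

text \<open>
  A recurrence for \<open>r\<close> turns multiplication by \<open>x\<close> into its Jacobi operator acting on the index of \<open>r\<close>.
  Two families multiplied together thus give two expressions for one value, which is the hyperbolic equation of
  \<open>jacobi_moment_products\<close>.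
\<close>

lemma moment_X_mult:
  assumes "three_term_recurrence a b c r"
  shows "moment ([:0, 1:] * (r i * q)) = jacobi a b c (\<lambda>i. moment (r i * q)) i"
proof -
  let ?lower = "if i = 0 then 0 else smult (c (i - 1)) (r (i - 1))"
  have "smult (a (Suc i)) (r (Suc i)) = [:- b i, 1:] * r i - ?lower"
    using assms unfolding three_term_recurrence_def by blast
  also have "[:- b i, 1:] * r i = [:0, 1:] * r i - smult (b i) (r i)"
    by simp
  finally have "[:0, 1:] * r i = smult (a (Suc i)) (r (Suc i)) + smult (b i) (r i) + ?lower"
    by (simp only: algebra_simps)
  then have "[:0, 1:] * (r i * q) = smult (a (Suc i)) (r (Suc i) * q) + smult (b i) (r i * q)
      + (if i = 0 then 0 else smult (c (i - 1)) (r (i - 1) * q))"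
    unfolding mult.assoc[symmetric] by (simp add: distrib_right)
  then show ?thesis
    by (simp add: jacobi_def moment_add moment_smult moment_0)
qed

lemma jacobi_moment_products:
  assumes "three_term_recurrence a b c r"
  shows "jacobi \<alpha> \<beta> \<gamma> (\<lambda>i. moment (p i * (r j * q))) i = jacobi a b c (\<lambda>j. moment (p i * (r j * q))) j"
  using moment_X_mult[OF recurrence, of i "r j * q"] moment_X_mult[OF assms, of j "p i * q"]
  by (simp add: mult.left_commute)

lemma moment_basis: "moment (p i) = (if i = 0 then 1 else 0)"
  by (simp add: moment_def expansion_coeff_basis)

lemma p_0: "p 0 = 1"
  using recurrence by (simp add: three_term_recurrence_def)

lemma moment_products_Suc:
  "\<alpha> (Suc j) * moment (p i * p (Suc j)) =
     jacobi \<alpha> \<beta> \<gamma> (\<lambda>i. moment (p i * p j)) i - \<beta> j * moment (p i * p j)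
     - (if j = 0 then 0 else \<gamma> (j - 1) * moment (p i * p (j - 1)))"
  using jacobi_moment_products[OF recurrence, where q = 1] by (simp add: jacobi_def)

text \<open>
  For \<open>i > j\<close>, raising \<open>j\<close> by one while keeping \<open>i > j + 1\<close> uses only values with first index at least
  \<open>i - 1\<close> and second index at most \<open>j\<close>; the first stays above the second, so the zeros
  of \<open>moment (p i)\<close> propagate.
\<close>

lemma moment_mult_eq_0: "j < i \<Longrightarrow> moment (p i * p j) = 0"
proof (induction j arbitrary: i rule: less_induct)
  case (less j)
  show ?case
  proof (cases j)
    case 0
    then show ?thesis using less.prems by (simp add: p_0 moment_basis)
  next
    case (Suc l)
    have "\<alpha> (Suc l) * moment (p i * p (Suc l)) = 0"
      unfolding moment_products_Suc jacobi_def using less Suc by auto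
    then show ?thesis using alpha_pos[of j] Suc by simp
  qed
qed

lemma orthogonality:
  assumes "i \<noteq> j"
  shows "moment (p i * p j) = 0"
  using assms moment_mult_eq_0[of i j] moment_mult_eq_0[of j i]
  by (cases i j rule: linorder_cases) (auto simp: mult.commute)

text \<open>
  Passing from \<open>j\<close> to \<open>j + 1\<close>, orthogonality leaves a single term of the recurrence, and the norm is
  multiplied by \<open>\<gamma> j / \<alpha> (j + 1)\<close>.
\<close>

lemma norm_pos: "moment (p j * p j) > 0"
proof (induction j)
  case 0
  then show ?case by (simp add: p_0 moment_basis[of 0, unfolded p_0])
next
  case (Suc j)
  have "\<alpha> (Suc j) * moment (p (Suc j) * p (Suc j)) = \<gamma> j * moment (p j * p j)"
    unfolding moment_products_Suc jacobi_def by (simp add: orthogonality)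
  then show ?case
    using Suc alpha_pos[of "Suc j"] gamma_pos[of j] by (metis Suc_le_mono le0 One_nat_def zero_less_mult_pos mult_pos_pos)
qed

lemma moment_mult_basis: "moment (q * p n) = expansion_coeff p q n * moment (p n * p n)"
proof -
  let ?c = "expansion_coeff p q"
  let ?A = "insert n {l. ?c l \<noteq> 0}"
  have fin: "finite ?A" using expands_as_coeff by (simp add: expands_as_def)
  have "q = (\<Sum>l\<in>?A. smult (?c l) (p l))"
    by (rule expands_as_sum[OF expands_as_coeff fin]) auto
  then have "q * p n = (\<Sum>l\<in>?A. smult (?c l) (p l * p n))"
    by (metis (no_types, lifting) mult_smult_left sum.cong sum_distrib_right)
  then have "moment (q * p n) = (\<Sum>l\<in>?A. ?c l * moment (p l * p n))"
    by (simp only: moment_sum moment_smult)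
  also have "\<dots> = (\<Sum>l\<in>{n}. ?c l * moment (p l * p n))"
    by (rule sum.mono_neutral_right[OF fin]) (auto simp: orthogonality)
  finally show ?thesis by simp
qed

end

section \<open>Nonnegative linearization\<close>

theorem corollary2:
  fixes \<alpha> \<beta> \<gamma> \<alpha>' \<beta>' \<gamma>' :: "nat \<Rightarrow> real"
    and p p' :: "nat \<Rightarrow> real poly"
    and m k n :: nat
  assumes "three_term_recurrence \<alpha> \<beta> \<gamma> p"
    and "three_term_recurrence \<alpha>' \<beta>' \<gamma>' p'"
    and "\<alpha> 0 = 0" and "\<alpha>' 0 = 0"
    and "\<forall>i\<ge>1. \<alpha> i > 0" and "\<forall>i\<ge>1. \<alpha>' i > 0"
    and "\<forall>i. \<gamma> i > 0" and "\<forall>i. \<gamma>' i > 0"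
    and "\<forall>i j. i \<le> j \<longrightarrow> \<beta> j \<ge> \<beta>' i"
    and "\<forall>i j. i \<le> j \<longrightarrow> \<alpha> j \<ge> \<alpha>' i"
    and "\<forall>i j. i \<le> j \<longrightarrow> \<alpha> j + \<gamma> j \<ge> \<alpha>' i + \<gamma>' i"
    and "\<forall>i j. i \<le> j \<longrightarrow> \<gamma> j \<ge> \<alpha>' i"
    and "k \<le> max m n"
  shows "linearization_coeff p p' m k n \<ge> 0"
proof -
  interpret P: orthogonal_polynomials \<alpha> \<beta> \<gamma> p
    by unfold_locales (use assms in blast)+
  interpret hyperbolic_coefficients \<alpha> \<beta> \<gamma> \<alpha>' \<beta>' \<gamma>'
    by unfold_locales (use assms in blast)+
  (* The index i takes the role of the variable of L; the third factor p l only fixes the functional,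
     so either of the indices m and n may serve as i. *)
  have triple: "P.moment (p i * (p' k * p l)) \<ge> 0" if "k \<le> i" for i l
  proof (rule hyperbolic_nonneg[OF P.jacobi_moment_products[OF assms(2)] _ that])
    have "p' 0 = 1" using assms(2) by (simp add: three_term_recurrence_def)
    then show "P.moment (p i * (p' 0 * p l)) \<ge> 0" for i
      using P.orthogonality[of i l] P.norm_pos[of l] by (cases "i = l") auto
  qed
  have "P.moment (p m * p' k * p n) \<ge> 0"
  proof (cases "k \<le> n")
    case True
    from triple[OF this, of m] show ?thesis by (simp add: mult_ac)
  next
    case False
    then have "k \<le> m" using assms(13) by auto
    from triple[OF this, of n] show ?thesis by (simp add: mult_ac)
  qed
  then show ?thesis
    using P.norm_pos[of n] P.moment_mult_basis[of "p m * p' k" n]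
    by (simp add: linearization_coeff_def zero_le_mult_iff)
qed

end
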